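(* Let $k\ge 1$ be an integer and $n=2k+1$. The least positive residue $t$ of the inverse of $2^k+3$ modulo $2^{2k+1}-1$ is given as follows, together with its binary weight $\mathrm{wt}(t)$: \begin{itemize} \item If $k\equiv 0 \pmod 8$, then $t = 2^k + \frac{2^{k}-1}{17}\left(13\cdot 2^{k+1}+7\right)$ and $\mathrm{wt}(t)=k+1$. \item If $k\equiv 1 \pmod 8$, then $t = 2^{k-1}+2^{k}+\frac{2^{k-1}-1}{17}\left(7\cdot 2^{k+2}+1\right)$ and $\mathrm{wt}(t)=k+1$. \item If $k\equiv 2 \pmod 8$, then $t = 1+2^{k+1}+\frac{2^{k-2}-1}{17}\left(5\cdot 2^{k+3}+16\right)$ and $\mathrm{wt}(t)=k$. \item If $k\equiv 3 \pmod 8$, then $t = 2^k+2^{k+2}+2^{k+3}+\frac{2^{k-3}-1}{17}\left(7\cdot 2^{k+5}+8\right)$ and $\mathrm{wt}(t)=k$. \item If $k\equiv 4 \pmod 8$, then $t = 2^{k-4}+2^{k-2}+2^{k-1}+2^{k+4}+\frac{2^{k-4}-1}{17}\left(9\cdot 2^{k+5}+3\right)$ and $\mathrm{wt}(t)=k$. \item If $k\equiv 5 \pmod 8$, then $t = 1+2^{k-3}+2^{k-1}+2^k+2^{k+1}+\frac{2^{k-5}-1}{17}\left(2^{k+6}+12\right)$ and $\mathrm{wt}(t)=k$. \item If $k\equiv 6 \pmod 8$, then $t = 2^{k-5}+2^{k-4}+2^{k-2}+2^{k+3}+2^{k+4}+2^{k+5}+2^{k+6}+\frac{2^{k-6}-1}{17}\left(16\cdot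 2^{k+7}+10\right)$ and $\mathrm{wt}(t)=k+1$. \item If $k\equiv 7 \pmod 8$, then $t = 2^{k-5}+2^{k-4}+2^{k-3}+2^{k-2}+2^{k+1}+2^{k+2}+2^{k+4}+2^{k+7}+\frac{2^{k-7}-1}{17}\left(10\cdot 2^{k+8}+4\right)$ and $\mathrm{wt}(t)=k+1$. \end{itemize}
   Context: For a nonnegative integer $v$ with binary representation $v=\sum_{i=0}^{l} v_i 2^i$, $v_i\in\{0,1\}$, the binary weight is $\mathrm{wt}(v)=\sum_{i=0}^l v_i$. The least positive residue of the inverse of $d$ modulo $M$ is the smallest positive integer $t$ with $d\cdot t\equiv 1 \pmod M$. *)

theory Defs
  imports
    Complex_Main
    "HOL-Library.Discrete_Functions"
    "HOL-Number_Theory.Cong"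
begin

text \<open>
  Binary weight: \<open>v div 2 ^ i mod 2\<close> is the \<open>i\<close>-th binary digit of \<open>v\<close>, and \<open>floor_log v\<close> is the
  index of the leading one (\<open>0\<close> if \<open>v = 0\<close>). By \<open>wt_binary_representation\<close> below, the weight can
  be read off any binary representation, leading zeros included.
\<close>

definition wt :: "nat \<Rightarrow> nat" where
  "wt v = (\<Sum>i\<le>floor_log v. v div 2 ^ i mod 2)"

lemma wt_rec: "wt v = v mod 2 + wt (v div 2)"
proof (cases "v < 2")
  case True
  then have "v = 0 \<or> v = 1" by auto
  then show ?thesis by (auto simp: wt_def)
next
  case False
  then have "floor_log v = Suc (floor_log (v div 2))"
    using floor_log_rec[of v] by simp
  then have "wt v = (\<Sum>i\<le>Suc (floor_log (v div 2)). v div 2 ^ i mod 2)"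
    unfolding wt_def by (rule arg_cong)
  also have "\<dots> = v mod 2 + (\<Sum>i\<le>floor_log (v div 2). v div 2 div 2 ^ i mod 2)"
    unfolding sum.atMost_Suc_shift by (simp add: div_mult2_eq)
  finally show ?thesis
    unfolding wt_def .
qed

lemma wt_binary_representation:
  assumes "\<And>i. i \<le> l \<Longrightarrow> b i \<in> {0, 1}" and "v = (\<Sum>i\<le>l. b i * 2 ^ i)"
  shows "wt v = (\<Sum>i\<le>l. b i)"
  using assms
proof (induction l arbitrary: b v)
  case 0
  then have "v = 0 \<or> v = 1" by auto
  with 0 show ?case by (auto simp: wt_def)
next
  case (Suc l)
  define w where "w = (\<Sum>i\<le>l. b (Suc i) * 2 ^ i)"
  have v: "v = b 0 + 2 * w"
    unfolding Suc.prems(2) w_def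
    by (simp add: sum.atMost_Suc_shift sum_distrib_left mult_ac del: sum.atMost_Suc)
  have "b 0 = 0 \<or> b 0 = 1" using Suc.prems(1)[of 0] by simp
  then have "v mod 2 = b 0" "v div 2 = w" using v by auto
  moreover have "wt w = (\<Sum>i\<le>l. b (Suc i))"
    by (rule Suc.IH) (use Suc.prems(1) w_def in auto)
  ultimately show ?case
    by (simp add: wt_rec[of v] sum.atMost_Suc_shift del: sum.atMost_Suc)
qed

definition is_least_pos_inverse :: "nat \<Rightarrow> nat \<Rightarrow> nat \<Rightarrow> bool" where
  "is_least_pos_inverse M d t \<longleftrightarrow>
     0 < t \<and> [d * t = 1] (mod M) \<and> (\<forall>s. 0 < s \<and> [d * s = 1] (mod M) \<longrightarrow> t \<le> s)"

lemma is_least_pos_inverse_unique: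
  "is_least_pos_inverse M d t \<Longrightarrow> is_least_pos_inverse M d t' \<Longrightarrow> t = t'"
  unfolding is_least_pos_inverse_def by (meson antisym)

end

theory Submission
  imports Defs
begin

text \<open>
  Write \<open>d = 2 ^ k + 3\<close> and \<open>M = 2 ^ (2 * k + 1) - 1\<close>. Modulo \<open>d\<close> we have \<open>2 ^ k \<equiv> - 3\<close>, hence
  \<open>M \<equiv> 2 * 9 - 1 = 17\<close>; this is where the denominator 17 comes from. The inverse \<open>t\<close> of \<open>d\<close> modulo
  \<open>M\<close> satisfies \<open>d * t = 1 + q * M\<close> where \<open>q\<close> is the residue of \<open>- 1 / 17\<close> modulo \<open>d\<close>, that is,
  \<open>q = (c * d - 1) / 17\<close> with \<open>c\<close> the inverse of \<open>d\<close> modulo 17. Since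
  \<open>M - 17 = 2 * (2 ^ k - 3) * d\<close>, division by \<open>d\<close> leaves the closed formula
  \<open>17 * t = c * M - 2 * (2 ^ k - 3)\<close>.
  The order of 2 modulo 17 is 8, so \<open>c\<close> depends only on \<open>r = k mod 8\<close>; this gives the eight cases.

  For the weight, let \<open>k = 8 * m + r\<close>. The number \<open>R = (256 ^ m - 1) / 17\<close> satisfies
  \<open>256 ^ m = 17 * R + 1\<close>, and the closed formula turns into a number that consists of two runs of
  \<open>m\<close> bytes, of the form \<open>c' * R\<close> with \<open>1 \<le> c' \<le> 16\<close>, and two digit strings which depend on \<open>r\<close> only.
  Each byte of such a run equals \<open>255 * c' / 17 = 15 * c'\<close> and has weight 4
  (\<open>wt_seventeenth_block\<close>): as \<open>2 ^ 4 \<equiv> - 1\<close> modulo 17, the lower half of the period of \<open>c' / 17\<close>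
  is the complement of the upper half. The two runs therefore contribute \<open>8 * m = k - r\<close> ones, and
  the constant strings contribute \<open>r\<close> or \<open>r + 1\<close> (\<open>inverse_and_weight\<close>).
\<close>

section \<open>Binary weight of concatenated digit strings\<close>

lemma wt_0 [simp]: "wt 0 = 0"
  by (simp add: wt_def)

lemma wt_1 [simp]: "wt 1 = 1" "wt (Suc 0) = 1"
  by (simp_all add: wt_def)

lemma wt_double [simp]: "wt (2 * v) = wt v" "wt (Suc (2 * v)) = Suc (wt v)"
  by (simp_all add: wt_rec[of "2 * v"] wt_rec[of "Suc (2 * v)"])

lemma wt_numeral [simp]:
  "wt (numeral (num.Bit0 w)) = wt (numeral w)"
  "wt (numeral (num.Bit1 w)) = Suc (wt (numeral w))"
  using wt_double[of "numeral w"] by simp_all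

lemma wt_append: "a < 2 ^ p \<Longrightarrow> wt (a + 2 ^ p * v) = wt a + wt v"
proof (induction p arbitrary: a)
  case (Suc p)
  have "(a + 2 ^ Suc p * v) mod 2 = a mod 2" "(a + 2 ^ Suc p * v) div 2 = a div 2 + 2 ^ p * v"
    by (simp_all add: mult.assoc)
  moreover have "wt (a div 2 + 2 ^ p * v) = wt (a div 2) + wt v"
    using Suc.prems by (intro Suc.IH) simp
  ultimately show ?case
    by (simp add: wt_rec[of "a + 2 ^ Suc p * v"] wt_rec[of a] del: power_Suc)
qed simp

section \<open>Periodic digit strings of fractions with denominator 17\<close>

definition seventeenth :: "nat \<Rightarrow> nat" where
  "seventeenth m = (256 ^ m - 1) div 17"

lemma power_256_eq: "256 ^ m = 17 * seventeenth m + 1"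
proof -
  have "[256 ^ m = 1 ^ m] (mod (17::nat))"
    by (rule cong_pow) (simp add: cong_def)
  then have "17 dvd 256 ^ m - (1::nat)"
    by (simp add: cong_altdef_nat)
  then show ?thesis
    by (simp add: seventeenth_def)
qed

lemma seventeenth_Suc: "seventeenth (Suc m) = 15 + 2 ^ 8 * seventeenth m"
  using power_256_eq[of m] power_256_eq[of "Suc m"] by simp

lemma seventeenth_multiple_less: "c \<le> 16 \<Longrightarrow> c * seventeenth m < 256 ^ m"
  using mult_right_mono[of c 16 "seventeenth m"] power_256_eq[of m] by linarith

text \<open>
  The byte \<open>15 * c = 16 * (c - 1) + (15 - (c - 1))\<close> consists of the four digits of \<open>c - 1\<close>
  followed by their complement, so that exactly four of its digits are ones.
\<close>

lemma wt_byte: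
  assumes "1 \<le> c" and "c \<le> 16"
  shows "wt (15 * c) = 4"
proof -
  have "c \<in> {1,2,3,4,5,6,7,8,9,10,11,12,13,14,15,16}"
    using assms by (simp, presburger)
  then show ?thesis
    by auto
qed

lemma wt_seventeenth_block:
  assumes "1 \<le> c" and "c \<le> 16"
  shows "wt (c * seventeenth m) = 4 * m"
proof (induction m)
  case 0
  show ?case by (simp add: seventeenth_def)
next
  case (Suc m)
  have "c * seventeenth (Suc m) = 15 * c + 2 ^ 8 * (c * seventeenth m)"
    by (simp add: seventeenth_Suc algebra_simps)
  with wt_append[of "15 * c" 8] wt_byte[OF assms] Suc.IH assms show ?case
    by simp
qed

lemma wt_two_blocks:
  assumes "a < 2 ^ p" and "b < 2 ^ q"
    and "1 \<le> c\<^sub>1" "c\<^sub>1 \<le> 16" and "1 \<le> c\<^sub>2" "c\<^sub>2 \<le> 16"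
  shows "wt (a + 2 ^ p * (c\<^sub>1 * seventeenth m + 256 ^ m * (b + 2 ^ q * (c\<^sub>2 * seventeenth m))))
    = wt a + wt b + 8 * m"
proof -
  have "(256::nat) ^ m = 2 ^ (8 * m)"
    by (simp add: power_mult)
  with seventeenth_multiple_less[of c\<^sub>1 m] assms show ?thesis
    by (simp add: wt_append wt_seventeenth_block)
qed

section \<open>The inverse in closed form\<close>

text \<open>
  A quotient \<open>q < d\<close> forces \<open>t \<le> M\<close>, and the interval from 1 to \<open>M\<close> contains exactly one
  representative of the inverse.
\<close>

lemma is_least_pos_inverseI:
  fixes d t q M :: nat
  assumes eq: "d * t = 1 + q * M" and "q < d" and "0 < M"
  shows "is_least_pos_inverse M d t"
  unfolding is_least_pos_inverse_def
proof (intro conjI allI impI)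
  show "0 < t"
    using eq by (cases t) auto
  show inv: "[d * t = 1] (mod M)"
    unfolding eq cong_def by (rule mod_mult_self1)
  have "d * t \<le> d * M"
  proof -
    have "d * t \<le> (q + 1) * M"
      using eq \<open>0 < M\<close> by simp
    also have "\<dots> \<le> d * M"
      using \<open>q < d\<close> by (intro mult_right_mono) auto
    finally show ?thesis .
  qed
  then have "t \<le> M"
    using \<open>q < d\<close> by simp
  fix s assume s: "0 < s \<and> [d * s = 1] (mod M)"
  show "t \<le> s"
  proof (rule ccontr)
    assume "\<not> t \<le> s"
    \<comment> \<open>Evaluating \<open>s * d * t\<close> in two ways shows that both inverses agree modulo \<open>M\<close>.\<close>
    have "[t * (d * s) = t * 1] (mod M)" "[s * (d * t) = s * 1] (mod M)"
      by (intro cong_scalar_left; use s inv in blast)+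
    then have "[t = s] (mod M)"
      by (simp add: cong_def ac_simps)
    then have "M dvd t - s"
      using \<open>\<not> t \<le> s\<close> by (simp add: cong_def mod_eq_dvd_iff_nat)
    then have "M \<le> t - s"
      using \<open>\<not> t \<le> s\<close> by (intro dvd_imp_le) auto
    then show False
      using \<open>t \<le> M\<close> \<open>\<not> t \<le> s\<close> s by linarith
  qed
qed

text \<open>
  The second hypothesis is \<open>17 * t = c * M - 2 * (2 ^ k - 3)\<close> without subtraction. Multiplied by
  \<open>d = 2 ^ k + 3\<close> it becomes \<open>17 * (d * t - 1) = (c * d - 1) * M\<close>, because
  \<open>2 * (2 ^ k - 3) * d = M - 17\<close>.
\<close>

lemma least_pos_inverse_closed_form:
  fixes c k t :: nat
  assumes c: "c * (2 ^ k + 3) = 1 + 17 * q" and "c < 17"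
    and t: "17 * t + 2 ^ (k + 1) + c = c * 2 ^ (2 * k + 1) + 6"
  shows "is_least_pos_inverse (2 ^ (2 * k + 1) - 1) (2 ^ k + 3) t"
proof (rule is_least_pos_inverseI)
  define x :: int where "x = 2 ^ k"
  have M: "2 ^ (2 * k + 1) = 2 * x\<^sup>2"
    by (simp add: x_def power_mult power2_eq_square flip: power_mult_distrib)
  have "int (c * (2 ^ k + 3)) = int (1 + 17 * q)"
    "int (17 * t + 2 ^ (k + 1) + c) = int (c * 2 ^ (2 * k + 1) + 6)"
    using c t by presburger+
  then have "int c * (x + 3) = 1 + 17 * int q"
    and "17 * int t + 2 * x + int c = int c * (2 * x\<^sup>2) + 6"
    unfolding M[symmetric] by (simp_all add: x_def)
  then have "17 * ((x + 3) * int t) = 17 * (1 + int q * (2 * x\<^sup>2 - 1))"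
    by algebra
  then have "int ((2 ^ k + 3) * t) = int (1 + q * (2 ^ (2 * k + 1) - 1))"
    unfolding M[symmetric] by (simp add: x_def of_nat_diff)
  then show "(2 ^ k + 3) * t = 1 + q * (2 ^ (2 * k + 1) - 1)"
    by presburger
  have "17 * q < c * (2 ^ k + 3)"
    using c by simp
  also have "\<dots> \<le> 17 * (2 ^ k + 3)"
    using \<open>c < 17\<close> by (intro mult_right_mono) auto
  finally show "q < 2 ^ k + 3"
    by simp
  show "0 < (2::nat) ^ (2 * k + 1) - 1"
    using one_less_power[of "2::nat" "2 * k + 1"] by simp
qed

text \<open>
  The parameters of a residue class \<open>r\<close> are \<open>c\<close>, the inverse of \<open>2 ^ r + 3\<close> modulo 17, and the digit
  strings of \<open>t\<close>: from the least significant end, \<open>a\<close> in \<open>p\<close> digits, a run of \<open>m\<close> bytes, \<open>b\<close>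
  in \<open>q\<close> digits, and another run of \<open>m\<close> bytes.
\<close>

lemma inverse_and_weight:
  fixes k m r t :: nat
  assumes k: "k = 8 * m + r"
    and c: "c < 17" "c * (2 ^ r + 3) mod 17 = 1"
    and t: "t = a + 2 ^ p * (c\<^sub>1 * seventeenth m + 256 ^ m * (b + 2 ^ q * (c\<^sub>2 * seventeenth m)))"
    and closed_form: "17 * t + 2 ^ (k + 1) + c = c * 2 ^ (2 * k + 1) + 6"
    and strings: "a < 2 ^ p" "b < 2 ^ q"
      "1 \<le> c\<^sub>1" "c\<^sub>1 \<le> 16" "1 \<le> c\<^sub>2" "c\<^sub>2 \<le> 16"
  shows "is_least_pos_inverse (2 ^ (2 * k + 1) - 1) (2 ^ k + 3) t" and "wt t = wt a + wt b + 8 * m"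
proof -
  define s where "s = c * (2 ^ r + 3) div 17"
  have "c * (2 ^ r + 3) = 1 + 17 * s"
    using c(2) mult_div_mod_eq[of 17 "c * (2 ^ r + 3)"] by (simp add: s_def)
  moreover have "2 ^ k = 2 ^ r * (17 * seventeenth m + 1)"
    unfolding k power_256_eq[symmetric] by (simp add: power_add power_mult)
  ultimately have "c * (2 ^ k + 3) = 1 + 17 * (s + c * 2 ^ r * seventeenth m)"
    by (simp add: algebra_simps)
  then show "is_least_pos_inverse (2 ^ (2 * k + 1) - 1) (2 ^ k + 3) t"
    using c(1) closed_form by (rule least_pos_inverse_closed_form)
  show "wt t = wt a + wt b + 8 * m"
    unfolding t using strings by (rule wt_two_blocks)
qed

section \<open>The eight residue classes\<close>

text \<open>
  Both orders of the factors in the exponent are listed since \<open>algebra_simps\<close> commutes them.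
\<close>

lemma powers_of_period:
  fixes m :: nat
  defines "x \<equiv> 17 * of_nat (seventeenth m) + (1 :: 'a :: comm_semiring_1)"
  shows "2 ^ (8 * m) = x" "2 ^ (m * 8) = x" "2 ^ (16 * m) = x * x" "2 ^ (m * 16) = x * x"
proof -
  have "(2 :: 'a) ^ (8 * m) = of_nat (256 ^ m)"
    by (simp add: power_mult)
  then show period: "2 ^ (8 * m) = x"
    by (simp add: power_256_eq x_def add.commute)
  then have "2 ^ (8 * m + 8 * m) = x * x"
    by (simp only: power_add)
  then show "2 ^ (16 * m) = x * x"
    by simp
  with period show "2 ^ (m * 8) = x" "2 ^ (m * 16) = x * x"
    by (simp_all only: mult.commute)
qed

text \<open>
  With \<open>2 ^ k = 2 ^ r * (17 * R + 1)\<close>, both the closed form and the stated value of \<open>t\<close> become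
  polynomial identities in \<open>R = seventeenth m\<close>. In the classes 2 and 5 the stated value contains
  \<open>1 + c' * R\<close> with \<open>c'\<close> even. There \<open>t\<close> is odd, and its last digit is split off as \<open>a = 1\<close>; the
  run \<open>c' * R\<close> becomes \<open>(c' div 2) * R\<close>, shifted by one place. In the other classes \<open>a\<close> is empty.
\<close>

lemmas class_simps = power_add powers_of_period power_256_eq algebra_simps

lemma residue_class_0:
  assumes "k = 8 * m + 0"
  shows "\<exists>t. is_least_pos_inverse (2 ^ (2 * k + 1) - 1) (2 ^ k + 3) t \<and>
    real t = 2 ^ k + (2 ^ k - 1) / 17 * (13 * 2 ^ (k + 1) + 7) \<and>
    wt t = k + 1"
proof -
  define t where
    "t = 0 + 2 ^ 0 * (7 * seventeenth m + 256 ^ m * (1 + 2 ^ 1 * (13 * seventeenth m)))"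
  have "17 * t + 2 ^ (k + 1) + 13 = 13 * 2 ^ (2 * k + 1) + 6"
    unfolding t_def by (simp add: assms class_simps)
  note inverse_and_weight[OF assms _ _ t_def this]
  moreover have "real t = 2 ^ k + (2 ^ k - 1) / 17 * (13 * 2 ^ (k + 1) + 7)"
    unfolding t_def by (simp add: assms class_simps)
  ultimately show ?thesis
    by (intro exI[of _ t]) (simp add: assms)
qed

lemma residue_class_1:
  assumes "k = 8 * m + 1"
  shows "\<exists>t. is_least_pos_inverse (2 ^ (2 * k + 1) - 1) (2 ^ k + 3) t \<and>
    real t = 2 ^ (k - 1) + 2 ^ k + (2 ^ (k - 1) - 1) / 17 * (7 * 2 ^ (k + 2) + 1) \<and>
    wt t = k + 1"
proof -
  define t where
    "t = 0 + 2 ^ 0 * (1 * seventeenth m + 256 ^ m * (3 + 2 ^ 3 * (7 * seventeenth m)))"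
  have "17 * t + 2 ^ (k + 1) + 7 = 7 * 2 ^ (2 * k + 1) + 6"
    unfolding t_def by (simp add: assms class_simps)
  note inverse_and_weight[OF assms _ _ t_def this]
  moreover have "real t = 2 ^ (k - 1) + 2 ^ k + (2 ^ (k - 1) - 1) / 17 * (7 * 2 ^ (k + 2) + 1)"
    unfolding t_def by (simp add: assms class_simps)
  ultimately show ?thesis
    by (intro exI[of _ t]) (simp add: assms)
qed

lemma residue_class_2:
  assumes "k = 8 * m + 2"
  shows "\<exists>t. is_least_pos_inverse (2 ^ (2 * k + 1) - 1) (2 ^ k + 3) t \<and>
    real t = 1 + 2 ^ (k + 1) + (2 ^ (k - 2) - 1) / 17 * (5 * 2 ^ (k + 3) + 16) \<and>
    wt t = k"
proof -
  define t where
    "t = 1 + 2 ^ 1 * (8 * seventeenth m + 256 ^ m * (4 + 2 ^ 4 * (5 * seventeenth m)))"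
  have "17 * t + 2 ^ (k + 1) + 5 = 5 * 2 ^ (2 * k + 1) + 6"
    unfolding t_def by (simp add: assms class_simps)
  note inverse_and_weight[OF assms _ _ t_def this]
  moreover have "real t = 1 + 2 ^ (k + 1) + (2 ^ (k - 2) - 1) / 17 * (5 * 2 ^ (k + 3) + 16)"
    unfolding t_def by (simp add: assms class_simps)
  ultimately show ?thesis
    by (intro exI[of _ t]) (simp add: assms)
qed

lemma residue_class_3:
  assumes "k = 8 * m + 3"
  shows "\<exists>t. is_least_pos_inverse (2 ^ (2 * k + 1) - 1) (2 ^ k + 3) t \<and>
    real t = 2 ^ k + 2 ^ (k + 2) + 2 ^ (k + 3)
      + (2 ^ (k - 3) - 1) / 17 * (7 * 2 ^ (k + 5) + 8) \<and>
    wt t = k"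
proof -
  define t where
    "t = 0 + 2 ^ 0 * (8 * seventeenth m + 256 ^ m * (104 + 2 ^ 8 * (7 * seventeenth m)))"
  have "17 * t + 2 ^ (k + 1) + 14 = 14 * 2 ^ (2 * k + 1) + 6"
    unfolding t_def by (simp add: assms class_simps)
  note inverse_and_weight[OF assms _ _ t_def this]
  moreover have "real t = 2 ^ k + 2 ^ (k + 2) + 2 ^ (k + 3)
      + (2 ^ (k - 3) - 1) / 17 * (7 * 2 ^ (k + 5) + 8)"
    unfolding t_def by (simp add: assms class_simps)
  ultimately show ?thesis
    by (intro exI[of _ t]) (simp add: assms)
qed

lemma residue_class_4:
  assumes "k = 8 * m + 4"
  shows "\<exists>t. is_least_pos_inverse (2 ^ (2 * k + 1) - 1) (2 ^ k + 3) t \<and>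
    real t = 2 ^ (k - 4) + 2 ^ (k - 2) + 2 ^ (k - 1) + 2 ^ (k + 4)
      + (2 ^ (k - 4) - 1) / 17 * (9 * 2 ^ (k + 5) + 3) \<and>
    wt t = k"
proof -
  define t where
    "t = 0 + 2 ^ 0 * (3 * seventeenth m + 256 ^ m * (269 + 2 ^ 9 * (9 * seventeenth m)))"
  have "17 * t + 2 ^ (k + 1) + 9 = 9 * 2 ^ (2 * k + 1) + 6"
    unfolding t_def by (simp add: assms class_simps)
  note inverse_and_weight[OF assms _ _ t_def this]
  moreover have "real t = 2 ^ (k - 4) + 2 ^ (k - 2) + 2 ^ (k - 1) + 2 ^ (k + 4)
      + (2 ^ (k - 4) - 1) / 17 * (9 * 2 ^ (k + 5) + 3)"
    unfolding t_def by (simp add: assms class_simps)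
  ultimately show ?thesis
    by (intro exI[of _ t]) (simp add: assms)
qed

lemma residue_class_5:
  assumes "k = 8 * m + 5"
  shows "\<exists>t. is_least_pos_inverse (2 ^ (2 * k + 1) - 1) (2 ^ k + 3) t \<and>
    real t = 1 + 2 ^ (k - 3) + 2 ^ (k - 1) + 2 ^ k + 2 ^ (k + 1)
      + (2 ^ (k - 5) - 1) / 17 * (2 ^ (k + 6) + 12) \<and>
    wt t = k"
proof -
  define t where
    "t = 1 + 2 ^ 1 * (6 * seventeenth m + 256 ^ m * (58 + 2 ^ 10 * (1 * seventeenth m)))"
  have "17 * t + 2 ^ (k + 1) + 1 = 1 * 2 ^ (2 * k + 1) + 6"
    unfolding t_def by (simp add: assms class_simps)
  note inverse_and_weight[OF assms _ _ t_def this]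
  moreover have "real t = 1 + 2 ^ (k - 3) + 2 ^ (k - 1) + 2 ^ k + 2 ^ (k + 1)
      + (2 ^ (k - 5) - 1) / 17 * (2 ^ (k + 6) + 12)"
    unfolding t_def by (simp add: assms class_simps)
  ultimately show ?thesis
    by (intro exI[of _ t]) (simp add: assms)
qed

lemma residue_class_6:
  assumes "k = 8 * m + 6"
  shows "\<exists>t. is_least_pos_inverse (2 ^ (2 * k + 1) - 1) (2 ^ k + 3) t \<and>
    real t = 2 ^ (k - 5) + 2 ^ (k - 4) + 2 ^ (k - 2) + 2 ^ (k + 3) + 2 ^ (k + 4)
      + 2 ^ (k + 5) + 2 ^ (k + 6)
      + (2 ^ (k - 6) - 1) / 17 * (16 * 2 ^ (k + 7) + 10) \<and>
    wt t = k + 1"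
proof -
  define t where
    "t = 0 + 2 ^ 0 * (10 * seventeenth m + 256 ^ m * (7702 + 2 ^ 13 * (16 * seventeenth m)))"
  have "17 * t + 2 ^ (k + 1) + 16 = 16 * 2 ^ (2 * k + 1) + 6"
    unfolding t_def by (simp add: assms class_simps)
  note inverse_and_weight[OF assms _ _ t_def this]
  moreover have "real t = 2 ^ (k - 5) + 2 ^ (k - 4) + 2 ^ (k - 2) + 2 ^ (k + 3) + 2 ^ (k + 4)
      + 2 ^ (k + 5) + 2 ^ (k + 6)
      + (2 ^ (k - 6) - 1) / 17 * (16 * 2 ^ (k + 7) + 10)"
    unfolding t_def by (simp add: assms class_simps)
  ultimately show ?thesis
    by (intro exI[of _ t]) (simp add: assms)
qed

lemma residue_class_7:
  assumes "k = 8 * m + 7"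
  shows "\<exists>t. is_least_pos_inverse (2 ^ (2 * k + 1) - 1) (2 ^ k + 3) t \<and>
    real t = 2 ^ (k - 5) + 2 ^ (k - 4) + 2 ^ (k - 3) + 2 ^ (k - 2) + 2 ^ (k + 1)
      + 2 ^ (k + 2) + 2 ^ (k + 4) + 2 ^ (k + 7)
      + (2 ^ (k - 7) - 1) / 17 * (10 * 2 ^ (k + 8) + 4) \<and>
    wt t = k + 1"
proof -
  define t where
    "t = 0 + 2 ^ 0 * (4 * seventeenth m + 256 ^ m * (19260 + 2 ^ 15 * (10 * seventeenth m)))"
  have "17 * t + 2 ^ (k + 1) + 10 = 10 * 2 ^ (2 * k + 1) + 6"
    unfolding t_def by (simp add: assms class_simps)
  note inverse_and_weight[OF assms _ _ t_def this]
  moreover have "real t = 2 ^ (k - 5) + 2 ^ (k - 4) + 2 ^ (k - 3) + 2 ^ (k - 2) + 2 ^ (k + 1)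
      + 2 ^ (k + 2) + 2 ^ (k + 4) + 2 ^ (k + 7)
      + (2 ^ (k - 7) - 1) / 17 * (10 * 2 ^ (k + 8) + 4)"
    unfolding t_def by (simp add: assms class_simps)
  ultimately show ?thesis
    by (intro exI[of _ t]) (simp add: assms)
qed

theorem theorem2p4:
  fixes k n :: nat
  assumes "k \<ge> 1" and "n = 2 * k + 1"
  shows "\<exists>t. is_least_pos_inverse (2 ^ n - 1) (2 ^ k + 3) t \<and>
    ([k = 0] (mod 8) \<longrightarrow>
       real t = 2 ^ k + (2 ^ k - 1) / 17 * (13 * 2 ^ (k + 1) + 7)
       \<and> wt t = k + 1) \<and>
    ([k = 1] (mod 8) \<longrightarrow>
       real t = 2 ^ (k - 1) + 2 ^ k + (2 ^ (k - 1) - 1) / 17 * (7 * 2 ^ (k + 2) + 1)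
       \<and> wt t = k + 1) \<and>
    ([k = 2] (mod 8) \<longrightarrow>
       real t = 1 + 2 ^ (k + 1) + (2 ^ (k - 2) - 1) / 17 * (5 * 2 ^ (k + 3) + 16)
       \<and> wt t = k) \<and>
    ([k = 3] (mod 8) \<longrightarrow>
       real t = 2 ^ k + 2 ^ (k + 2) + 2 ^ (k + 3)
         + (2 ^ (k - 3) - 1) / 17 * (7 * 2 ^ (k + 5) + 8)
       \<and> wt t = k) \<and>
    ([k = 4] (mod 8) \<longrightarrow>
       real t = 2 ^ (k - 4) + 2 ^ (k - 2) + 2 ^ (k - 1) + 2 ^ (k + 4)
         + (2 ^ (k - 4) - 1) / 17 * (9 * 2 ^ (k + 5) + 3)
       \<and> wt t = k) \<and>
    ([k = 5] (mod 8) \<longrightarrow>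
       real t = 1 + 2 ^ (k - 3) + 2 ^ (k - 1) + 2 ^ k + 2 ^ (k + 1)
         + (2 ^ (k - 5) - 1) / 17 * (2 ^ (k + 6) + 12)
       \<and> wt t = k) \<and>
    ([k = 6] (mod 8) \<longrightarrow>
       real t = 2 ^ (k - 5) + 2 ^ (k - 4) + 2 ^ (k - 2) + 2 ^ (k + 3) + 2 ^ (k + 4)
         + 2 ^ (k + 5) + 2 ^ (k + 6)
         + (2 ^ (k - 6) - 1) / 17 * (16 * 2 ^ (k + 7) + 10)
       \<and> wt t = k + 1) \<and>
    ([k = 7] (mod 8) \<longrightarrow>
       real t = 2 ^ (k - 5) + 2 ^ (k - 4) + 2 ^ (k - 3) + 2 ^ (k - 2) + 2 ^ (k + 1)
         + 2 ^ (k + 2) + 2 ^ (k + 4) + 2 ^ (k + 7)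
         + (2 ^ (k - 7) - 1) / 17 * (10 * 2 ^ (k + 8) + 4)
       \<and> wt t = k + 1)"
proof -
  define m where "m = k div 8"
  have k: "k = 8 * m + k mod 8"
    by (simp add: m_def)
  have "k mod 8 < 8"
    by simp
  then consider "k mod 8 = 0" | "k mod 8 = 1" | "k mod 8 = 2" | "k mod 8 = 3"
    | "k mod 8 = 4" | "k mod 8 = 5" | "k mod 8 = 6" | "k mod 8 = 7"
    by linarith
  then show ?thesis
  proof cases
    case 1
    with k residue_class_0[of k m] show ?thesis
      unfolding \<open>n = 2 * k + 1\<close> by (auto simp: cong_def)
  next
    case 2
    with k residue_class_1[of k m] show ?thesis
      unfolding \<open>n = 2 * k + 1\<close> by (auto simp: cong_def)
  next
    case 3
    with k residue_class_2[of k m] show ?thesis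
      unfolding \<open>n = 2 * k + 1\<close> by (auto simp: cong_def)
  next
    case 4
    with k residue_class_3[of k m] show ?thesis
      unfolding \<open>n = 2 * k + 1\<close> by (auto simp: cong_def)
  next
    case 5
    with k residue_class_4[of k m] show ?thesis
      unfolding \<open>n = 2 * k + 1\<close> by (auto simp: cong_def)
  next
    case 6
    with k residue_class_5[of k m] show ?thesis
      unfolding \<open>n = 2 * k + 1\<close> by (auto simp: cong_def)
  next
    case 7
    with k residue_class_6[of k m] show ?thesis
      unfolding \<open>n = 2 * k + 1\<close> by (auto simp: cong_def)
  next
    case 8
    with k residue_class_7[of k m] show ?thesis
      unfolding \<open>n = 2 * k + 1\<close> by (auto simp: cong_def)
  qed
qed

end
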